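(* Let $V$ be a three-dimensional vector space over $\mathbb{K}$ with basis $(x_1,x_2,x_3)$, equipped with the skew-symmetric bilinear bracket determined by $[x_1,x_2]=2x_2$, $[x_1,x_3]=-2x_3$, $[x_2,x_3]=x_1$. For a linear map $\alpha:V\to V$, the triple $(V,[\cdot,\cdot],\alpha)$ is a Hom-Lie algebra if and only if the matrix of $\alpha$ with respect to the basis $(x_1,x_2,x_3)$ is of the form $$\begin{pmatrix} a & d & c\\ 2c & b & f\\ 2d & e & b\end{pmatrix}$$ where $a,b,c,d,e,f\in\mathbb{K}$ are arbitrary parameters.
   Context: $\mathbb{K}$ is an algebraically closed field of characteristic $0$. A Hom-Lie algebra is a triple $(V,[\cdot,\cdot],\alpha)$ with $[\cdot,\cdot]:V\times V\to V$ bilinear and $\alpha:V\to V$ linear such that $[x,y]=-[y,x]$ and $[\alpha(x),[y,z]]+[\alpha(y),[z,x]]+[\alpha(z),[x,y]]=0$ for all $x,y,z\in V$. The matrix of $\alpha$ follows the column convention: the $j$-th column consists of the coordinates of $\alpha(x_j)$ in the basis $(x_1,x_2,x_3)$. *)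

theory Defs
  imports "HOL-Analysis.Analysis"
begin

context vector_space
begin

text \<open>The bilinear maps of HOL-Analysis are over the reals only; this is the same notion over
  an arbitrary field.\<close>

definition bilinear_map :: "('b \<Rightarrow> 'b \<Rightarrow> 'b) \<Rightarrow> bool"
  where "bilinear_map f \<longleftrightarrow>
    (\<forall>x. Vector_Spaces.linear scale scale (\<lambda>y. f x y)) \<and>
    (\<forall>y. Vector_Spaces.linear scale scale (\<lambda>x. f x y))"

text \<open>An ordered basis indexed by \<^typ>\<open>'n\<close>; in the index type \<^typ>\<open>3\<close> the elements are
  \<open>1\<close>, \<open>2\<close>, \<open>3\<close>, with \<open>3 = 0\<close>. Injectivity is needed because \<open>range x\<close> forgets repetitions.\<close>

definition ordered_basis :: "('n::finite \<Rightarrow> 'b) \<Rightarrow> bool"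
  where "ordered_basis x \<longleftrightarrow> inj x \<and> independent (range x) \<and> span (range x) = UNIV"

text \<open>Since \<open>A $ i $ j\<close> is the entry in row \<open>i\<close> and column \<open>j\<close>, column \<open>j\<close> holds the
  coordinates of \<open>f (x j)\<close>.\<close>

definition matrix_in_basis :: "('n::finite \<Rightarrow> 'b) \<Rightarrow> ('b \<Rightarrow> 'b) \<Rightarrow> 'a^'n^'n"
  where "matrix_in_basis x f = (\<chi> i j. representation (range x) (f (x j)) (x i))"

end

locale hom_lie_algebra = vector_space scale
  for scale :: "'a::field \<Rightarrow> 'b::ab_group_add \<Rightarrow> 'b" +
  fixes bracket :: "'b \<Rightarrow> 'b \<Rightarrow> 'b"
    and \<alpha> :: "'b \<Rightarrow> 'b"
  assumes bilinear_bracket: "bilinear_map bracket"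
    and linear_twist: "Vector_Spaces.linear scale scale \<alpha>"
    and skew_symmetric: "bracket x y = - bracket y x"
    and hom_Jacobi: "bracket (\<alpha> x) (bracket y z) + bracket (\<alpha> y) (bracket z x)
      + bracket (\<alpha> z) (bracket x y) = 0"

end

theory Submission
  imports Defs
begin

text \<open>
  The cyclic sum of the Hom-Jacobi identity, here called the Hom-Jacobiator, is a trilinear map,
  and skew symmetry of the bracket makes it alternating once \<open>2\<close> is invertible. On a
  three-dimensional space an alternating trilinear map is determined by its value at the basis
  \<open>(x\<^sub>1, x\<^sub>2, x\<^sub>3)\<close>: on a triple of basis vectors it is zero if two of them coincide and plus or
  minus that one value otherwise (\<open>hom_Jacobiator_eq_0_iff_basis\<close>). So the Hom-Jacobi identity
  amounts to a single vector equation, that is, to three scalar equations.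

  For the bracket at hand, which is that of \<open>sl\<^sub>2\<close>, the Hom-Jacobiator of the basis
  is \<open>[\<alpha>(x\<^sub>1), x\<^sub>1] + 2 [\<alpha>(x\<^sub>2), x\<^sub>3] + 2 [\<alpha>(x\<^sub>3), x\<^sub>2]\<close>. With \<open>\<alpha>(x\<^sub>j) = m\<^sub>1\<^sub>j x\<^sub>1 + m\<^sub>2\<^sub>j x\<^sub>2 + m\<^sub>3\<^sub>j x\<^sub>3\<close>
  the equation therefore reads
  \<open>2 (m\<^sub>2\<^sub>2 - m\<^sub>3\<^sub>3) x\<^sub>1 + 2 (2 m\<^sub>1\<^sub>3 - m\<^sub>2\<^sub>1) x\<^sub>2 + 2 (m\<^sub>3\<^sub>1 - 2 m\<^sub>1\<^sub>2) x\<^sub>3 = 0\<close>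
  (\<open>hom_Jacobiator_sl2_basis\<close>). By linear independence the conditions are \<open>m\<^sub>2\<^sub>2 = m\<^sub>3\<^sub>3\<close>,
  \<open>m\<^sub>2\<^sub>1 = 2 m\<^sub>1\<^sub>3\<close> and \<open>m\<^sub>3\<^sub>1 = 2 m\<^sub>1\<^sub>2\<close>, which is the stated shape; the remaining six
  entries are the free parameters.
\<close>

definition hom_Jacobiator :: "('b \<Rightarrow> 'b \<Rightarrow> 'b) \<Rightarrow> ('b \<Rightarrow> 'b) \<Rightarrow> 'b \<Rightarrow> 'b \<Rightarrow> 'b \<Rightarrow> 'b::ab_group_add"
  where "hom_Jacobiator br \<alpha> u v w =
    br (\<alpha> u) (br v w) + br (\<alpha> v) (br w u) + br (\<alpha> w) (br u v)"

lemma hom_Jacobiator_cyclic: "hom_Jacobiator br \<alpha> u v w = hom_Jacobiator br \<alpha> v w u"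
  by (simp add: hom_Jacobiator_def ac_simps)

context vector_space
begin

lemma bilinear_map_add_right: "bilinear_map f \<Longrightarrow> f u (v + w) = f u v + f u w"
  and bilinear_map_add_left: "bilinear_map f \<Longrightarrow> f (u + v) w = f u w + f v w"
  and bilinear_map_scale_right: "bilinear_map f \<Longrightarrow> f u (scale c v) = scale c (f u v)"
  and bilinear_map_scale_left: "bilinear_map f \<Longrightarrow> f (scale c u) v = scale c (f u v)"
  by (simp_all add: bilinear_map_def Vector_Spaces.linear_iff)

lemmas bilinear_map_simps =
  bilinear_map_add_right bilinear_map_add_left bilinear_map_scale_right bilinear_map_scale_left

lemma eq_0_if_eq_uminus:
  fixes v :: 'b
  assumes "(2::'a) \<noteq> 0" and "v = - v"
  shows "v = 0"
proof -
  have "scale 2 v = v + v"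
    by (metis one_add_one scale_left_distrib scale_one)
  also have "\<dots> = 0"
    using assms(2) by (metis add.right_inverse)
  finally show ?thesis
    using assms(1) by simp
qed

lemma ordered_basis_eq_sum_matrix_in_basis:
  assumes "ordered_basis x"
  shows "f (x j) = (\<Sum>i\<in>UNIV. scale (matrix_in_basis x f $ i $ j) (x i))"
proof -
  have x: "inj x" "independent (range x)" "f (x j) \<in> span (range x)"
    using assms by (auto simp: ordered_basis_def)
  have "f (x j) = (\<Sum>v\<in>range x. scale (representation (range x) (f (x j)) v) v)"
    using x by (simp add: sum_representation_eq)
  also have "\<dots> = (\<Sum>i\<in>UNIV. scale (representation (range x) (f (x j)) (x i)) (x i))"
    using x by (simp add: sum.reindex)
  finally show ?thesis
    by (simp add: matrix_in_basis_def)
qed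

lemma ordered_basis_sum_eq_0_iff:
  assumes "ordered_basis x"
  shows "(\<Sum>i\<in>UNIV. scale (c i) (x i)) = 0 \<longleftrightarrow> (\<forall>i. c i = 0)"
proof
  have x: "inj x" "independent (range x)"
    using assms by (auto simp: ordered_basis_def)
  assume "(\<Sum>i\<in>UNIV. scale (c i) (x i)) = 0"
  then have "(\<Sum>v\<in>range x. scale (c (inv x v)) v) = 0"
    using x by (simp add: sum.reindex)
  then have "\<forall>v\<in>range x. c (inv x v) = 0"
    using x(2) dependent_finite[of "range x"] by auto
  then show "\<forall>i. c i = 0"
    using x(1) by simp
qed simp

lemma linear_eq_0_if_eq_0_on_ordered_basis:
  assumes "ordered_basis x" and "Vector_Spaces.linear scale scale f" and "\<And>i. f (x i) = 0"
  shows "f v = 0"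
proof -
  interpret f: Vector_Spaces.linear scale scale f by fact
  have "v \<in> span (range x)"
    using assms(1) by (simp add: ordered_basis_def)
  then show ?thesis
    by (rule f.eq_0_on_span[rotated]) (use assms(3) in blast)
qed

lemma hom_Jacobiator_swap:
  assumes "bilinear_map br" and skew: "\<And>u v. br u v = - br v u"
  shows "hom_Jacobiator br \<alpha> v u w = - hom_Jacobiator br \<alpha> u v w"
proof -
  have flip: "br p (br q r) = - br p (br r q)" for p q r
  proof -
    have "br p (br q r) + br p (br r q) = br p (br q r + br r q)"
      using assms(1) by (simp add: bilinear_map_simps)
    \<comment> \<open>Zero is written as a multiple so that homogeneity gives its bracket with \<open>p\<close>.\<close>
    also have "br q r + br r q = scale 0 p"
      by (subst skew) simp
    also have "br p (scale 0 p) = 0"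
      unfolding bilinear_map_scale_right[OF assms(1)] by simp
    finally show ?thesis
      by (simp add: eq_neg_iff_add_eq_0)
  qed
  show ?thesis
    unfolding hom_Jacobiator_def
    by (subst flip[of _ u w], subst flip[of _ w v], subst flip[of _ v u]) simp
qed

lemma linear_hom_Jacobiator:
  assumes "bilinear_map br" and "Vector_Spaces.linear scale scale \<alpha>"
  shows "Vector_Spaces.linear scale scale (hom_Jacobiator br \<alpha> u v)"
  using assms(2)
  by (simp add: Vector_Spaces.linear_iff hom_Jacobiator_def bilinear_map_simps[OF assms(1)]
      scale_right_distrib ac_simps)

text \<open>An alternating trilinear map in dimension three is a multiple of the determinant, and its
  value at a basis is that multiple.\<close>

lemma hom_Jacobiator_eq_0_iff_basis:
  fixes x :: "3 \<Rightarrow> 'b"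
  assumes "(2::'a) \<noteq> 0" and basis: "ordered_basis x" and bil: "bilinear_map br"
    and skew: "\<And>u v. br u v = - br v u" and lin: "Vector_Spaces.linear scale scale \<alpha>"
  shows "(\<forall>u v w. hom_Jacobiator br \<alpha> u v w = 0) \<longleftrightarrow> hom_Jacobiator br \<alpha> (x 1) (x 2) (x 3) = 0"
proof
  let ?J = "hom_Jacobiator br \<alpha>"
  assume J123: "?J (x 1) (x 2) (x 3) = 0"
  note swap = hom_Jacobiator_swap[OF bil skew, of \<alpha>]
  note cyclic = hom_Jacobiator_cyclic[of br \<alpha>]
  have J_same: "?J u u w = 0" "?J u w u = 0" "?J w u u = 0" for u w
  proof -
    show "?J u u w = 0"
      using assms(1) swap by (rule eq_0_if_eq_uminus)
    then show "?J u w u = 0" "?J w u u = 0"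
      by (metis cyclic)+
  qed
  have J_even: "?J (x 2) (x 3) (x 1) = 0" "?J (x 3) (x 1) (x 2) = 0"
    using J123 by (metis cyclic)+
  have J_odd: "?J (x 2) (x 1) (x 3) = 0" "?J (x 3) (x 2) (x 1) = 0" "?J (x 1) (x 3) (x 2) = 0"
    using J123 J_even by (metis swap neg_0_equal_iff_equal)+
  have "\<forall>i j k. ?J (x i) (x j) (x k) = 0"
    by (simp add: forall_3 J123 J_same J_even J_odd)
  moreover have extend: "?J u v w = 0" if "\<And>k. ?J u v (x k) = 0" for u v w
    using basis linear_hom_Jacobiator[OF bil lin] that by (rule linear_eq_0_if_eq_0_on_ordered_basis)
  \<comment> \<open>Linearity in the last argument suffices: cyclic rotation brings each argument there in turn.\<close>
  ultimately have "?J (x i) (x j) w = 0" for i j w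
    by blast
  then have "?J (x j) w (x i) = 0" for i j w
    by (metis cyclic)
  then have "?J (x j) w v = 0" for j w v
    by (rule extend)
  then have "?J w v (x j) = 0" for j w v
    by (metis cyclic)
  then show "\<forall>u v w. ?J u v w = 0"
    using extend by blast
qed simp

lemma hom_Jacobiator_sl2_basis:
  fixes x :: "3 \<Rightarrow> 'b" and \<alpha> :: "'b \<Rightarrow> 'b"
  defines "m \<equiv> matrix_in_basis x \<alpha>"
  assumes two: "(2::'a) \<noteq> 0" and basis: "ordered_basis x" and bil: "bilinear_map br"
    and skew: "\<And>u v. br u v = - br v u"
    and br12: "br (x 1) (x 2) = scale 2 (x 2)"
    and br13: "br (x 1) (x 3) = scale (-2) (x 3)"
    and br23: "br (x 2) (x 3) = x 1"
  shows "hom_Jacobiator br \<alpha> (x 1) (x 2) (x 3) =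
    scale (2 * (m$2$2 - m$3$3)) (x 1) + scale (2 * (2 * m$1$3 - m$2$1)) (x 2)
      + scale (2 * (m$3$1 - 2 * m$1$2)) (x 3)"
proof -
  have \<alpha>: "\<alpha> (x j) = scale (m$1$j) (x 1) + scale (m$2$j) (x 2) + scale (m$3$j) (x 3)" for j
    using ordered_basis_eq_sum_matrix_in_basis[OF basis, of \<alpha> j] by (simp add: m_def sum_3)
  have self: "br u u = 0" for u
    using two skew by (rule eq_0_if_eq_uminus)
  have br21: "br (x 2) (x 1) = scale (-2) (x 2)"
    using skew[of "x 2" "x 1"] br12 by simp
  have br31: "br (x 3) (x 1) = scale 2 (x 3)"
    using skew[of "x 3" "x 1"] br13 by simp
  have br32: "br (x 3) (x 2) = - x 1"
    using skew[of "x 3" "x 2"] br23 by simp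
  have "br (\<alpha> (x 1)) (x 1) = scale (- 2 * m$2$1) (x 2) + scale (2 * m$3$1) (x 3)"
    by (simp add: \<alpha> bilinear_map_simps[OF bil] self br21 br31 mult.commute)
  moreover have "br (\<alpha> (x 2)) (scale 2 (x 3)) = scale (2 * m$2$2) (x 1) - scale (4 * m$1$2) (x 3)"
    by (simp add: \<alpha> bilinear_map_simps[OF bil] self br13 br23 scale_right_distrib
        scale_right_diff_distrib mult.commute)
  moreover have "br (\<alpha> (x 3)) (scale 2 (x 2)) = scale (4 * m$1$3) (x 2) - scale (2 * m$3$3) (x 1)"
    by (simp add: \<alpha> bilinear_map_simps[OF bil] self br12 br32 scale_right_distrib
        scale_right_diff_distrib mult.commute)
  ultimately show ?thesis
    by (simp add: hom_Jacobiator_def br12 br31 br23 right_diff_distrib scale_left_diff_distrib)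
qed

end

theorem proposition6p1:
  fixes scale :: "'k::{alg_closed_field,field_char_0} \<Rightarrow> 'v::ab_group_add \<Rightarrow> 'v"
    and x :: "3 \<Rightarrow> 'v"
    and bracket :: "'v \<Rightarrow> 'v \<Rightarrow> 'v"
    and \<alpha> :: "'v \<Rightarrow> 'v"
  assumes "vector_space scale"
    and "vector_space.ordered_basis scale x"
    and "vector_space.bilinear_map scale bracket"
    and "\<And>u v. bracket u v = - bracket v u"
    and "bracket (x 1) (x 2) = scale 2 (x 2)"
    and "bracket (x 1) (x 3) = scale (-2) (x 3)"
    and "bracket (x 2) (x 3) = x 1"
    and "Vector_Spaces.linear scale scale \<alpha>"
  shows "hom_lie_algebra scale bracket \<alpha> \<longleftrightarrow>
    (\<exists>a b c d e f :: 'k. vector_space.matrix_in_basis scale x \<alpha> =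
      vector [vector [a,     d, c],
              vector [2 * c, b, f],
              vector [2 * d, e, b]])"
proof -
  interpret vector_space scale by fact
  define m where "m = matrix_in_basis x \<alpha>"
  have "hom_lie_algebra scale bracket \<alpha> \<longleftrightarrow> (\<forall>u v w. hom_Jacobiator bracket \<alpha> u v w = 0)"
    unfolding hom_lie_algebra_def hom_lie_algebra_axioms_def hom_Jacobiator_def
    using assms(1,3,4,8) by blast
  also have "\<dots> \<longleftrightarrow> hom_Jacobiator bracket \<alpha> (x 1) (x 2) (x 3) = 0"
    by (rule hom_Jacobiator_eq_0_iff_basis[OF _ assms(2-4,8)]) simp
  also have "\<dots> \<longleftrightarrow> scale (2 * (m$2$2 - m$3$3)) (x 1) + scale (2 * (2 * m$1$3 - m$2$1)) (x 2)
      + scale (2 * (m$3$1 - 2 * m$1$2)) (x 3) = 0"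
    unfolding m_def by (subst hom_Jacobiator_sl2_basis[OF _ assms(2-7)]) simp_all
  also have "\<dots> \<longleftrightarrow> m$2$2 = m$3$3 \<and> m$2$1 = 2 * m$1$3 \<and> m$3$1 = 2 * m$1$2"
    using ordered_basis_sum_eq_0_iff[OF assms(2), where c = "($) (vector
        [2 * (m$2$2 - m$3$3), 2 * (2 * m$1$3 - m$2$1), 2 * (m$3$1 - 2 * m$1$2)])"]
    by (auto simp: sum_3 forall_3)
  also have "\<dots> \<longleftrightarrow> (\<exists>a b c d e f. m =
      vector [vector [a, d, c], vector [2 * c, b, f], vector [2 * d, e, b]])"
    by (auto simp: vec_eq_iff forall_3)
  finally show ?thesis
    unfolding m_def .
qed

end
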